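(* Let $n$ be a positive integer, let $\mathbb{F}$ be a field, and let $\mathcal{V}\subseteq\mathbb{F}^n$ be a non-empty finite subset of the affine space $\mathbb{F}^n$. Then $$\frac{n\cdot|\mathcal{V}|^{\frac1n}}{e}-n<AC(\mathcal{V}),$$ i.e. there exists a vector $\mathbf{v}\in\mathcal{V}$ such that $\frac{n\cdot|\mathcal{V}|^{\frac1n}}{e}-n<AC(\mathcal{V},\mathbf{v})$.
   Context: Here $e$ is the base of the natural logarithm. For a finite set of points $\mathcal{V}\subseteq\mathbb{F}^n$ and $\mathbf{v}\in\mathcal{V}$, a finite (possibly empty) set of affine hyperplanes $\{H_1,\ldots,H_m\}$ of $\mathbb{F}^n$ is an almost cover of $\mathcal{V}$ and $\mathbf{v}$ if the union $\bigcup_{j=1}^m H_j$ contains $\mathcal{V}\setminus\{\mathbf{v}\}$ but does not contain $\mathbf{v}$. $AC(\mathcal{V},\mathbf{v})$ denotes the minimum size (number of hyperplanes) of an almost cover of $\mathcal{V}$ and $\mathbf{v}$, and $AC(\mathcal{V}):=\max_{\mathbf{v}\in\mathcal{V}}AC(\mathcal{V},\mathbf{v})$. *)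

theory Defs
  imports "HOL-Analysis.Analysis"
begin

definition affine_hyperplane :: "('f::field ^ 'n) set \<Rightarrow> bool" where
  "affine_hyperplane H \<longleftrightarrow>
     (\<exists>a b. a \<noteq> 0 \<and> H = {x. (\<Sum>i\<in>UNIV. a $ i * x $ i) = b})"

definition almost_cover ::
    "('f::field ^ 'n) set \<Rightarrow> 'f ^ 'n \<Rightarrow> ('f ^ 'n) set set \<Rightarrow> bool" where
  "almost_cover V v Hs \<longleftrightarrow>
     finite Hs \<and> (\<forall>H\<in>Hs. affine_hyperplane H) \<and> V - {v} \<subseteq> \<Union>Hs \<and> v \<notin> \<Union>Hs"

definition AC_at :: "('f::field ^ 'n) set \<Rightarrow> 'f ^ 'n \<Rightarrow> nat" where
  "AC_at V v = (LEAST m. \<exists>Hs. almost_cover V v Hs \<and> card Hs = m)"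

definition AC :: "('f::field ^ 'n) set \<Rightarrow> nat" where
  "AC V = Max (AC_at V ` V)"

text \<open>Almost covers of finite sets exist over every field, so the minimum
  \<^const>\<open>AC_at\<close> is attained.\<close>

lemma separating_hyperplane:
  fixes v w :: "'f::field ^ 'n"
  assumes "w \<noteq> v"
  shows "\<exists>H. affine_hyperplane H \<and> w \<in> H \<and> v \<notin> H"
proof -
  obtain j where j: "w $ j \<noteq> v $ j"
    using assms by (auto simp: vec_eq_iff)
  define a :: "'f ^ 'n" where "a = axis j 1"
  have a: "(\<Sum>i\<in>UNIV. a $ i * x $ i) = x $ j" for x :: "'f ^ 'n"
    by (simp add: a_def axis_def if_distrib[of "\<lambda>c. c * _"] cong: if_cong)
  have "a \<noteq> 0"
    by (simp add: a_def)
  then have "affine_hyperplane {x. (\<Sum>i\<in>UNIV. a $ i * x $ i) = w $ j}"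
    unfolding affine_hyperplane_def by blast
  then show ?thesis
    using j by (intro exI[of _ "{x. (\<Sum>i\<in>UNIV. a $ i * x $ i) = w $ j}"]) (simp add: a)
qed

lemma almost_cover_exists:
  assumes "finite V"
  shows "\<exists>Hs. almost_cover V v Hs"
proof -
  obtain h where h: "\<And>w. w \<noteq> v \<Longrightarrow> affine_hyperplane (h w) \<and> w \<in> h w \<and> v \<notin> h w"
    using separating_hyperplane[of _ v] by metis
  have "almost_cover V v (h ` (V - {v}))"
    unfolding almost_cover_def using assms h by auto
  then show ?thesis by blast
qed

lemma AC_at_attained:
  assumes "finite V"
  shows "\<exists>Hs. almost_cover V v Hs \<and> card Hs = AC_at V v"
proof -
  from almost_cover_exists[OF assms] obtain Hs where "almost_cover V v Hs" by blast
  then have "\<exists>Hs'. almost_cover V v Hs' \<and> card Hs' = card Hs" by blast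
  then show ?thesis unfolding AC_at_def by (rule LeastI)
qed

end

theory Submission
  imports Defs "HOL-Library.Function_Algebras" "HOL-Library.Multiset"
begin

text \<open>For every \<open>v \<in> V\<close>, the product of the affine forms defining a minimum almost cover is a
  polynomial of degree at most \<open>d = AC V\<close> that vanishes on \<open>V - {v}\<close> but not at \<open>v\<close>. These
  \<open>card V\<close> polynomials are linearly independent, so \<open>card V\<close> is at most the number
  \<open>(n + d) choose d\<close> of monomials of degree at most \<open>d\<close> in \<open>n\<close> variables. The claim then follows
  from \<open>((n + d) choose n) * n! \<le> (n + d) ^ n\<close> and \<open>n! > (n / e) ^ n\<close>.\<close>

text \<open>Makes span, independence and dimension bounds available for functions into
  \<open>'f\<close> under pointwise operations.\<close>

interpretation fun_space: vector_space "\<lambda>(c::'f::field) (f::'a \<Rightarrow> 'f) x. c * f x"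
  by standard (auto simp: fun_eq_iff algebra_simps)

lemma sum_fun_apply: "(\<Sum>i\<in>A. f i) x = (\<Sum>i\<in>A. f i x)"
  for f :: "'i \<Rightarrow> 'a \<Rightarrow> 'b::comm_monoid_add"
  by (induction A rule: infinite_finite_induct) auto

text \<open>Polynomials of degree at most \<open>d\<close> are homogenised: \<^term>\<open>None\<close> stands for the additional
  variable, which is evaluated at \<open>1\<close>.\<close>

definition coord :: "'n option \<Rightarrow> 'f::field ^ 'n \<Rightarrow> 'f" where
  "coord j x = (case j of None \<Rightarrow> 1 | Some i \<Rightarrow> x $ i)"

definition monomial :: "'n option multiset \<Rightarrow> 'f::field ^ 'n \<Rightarrow> 'f" where
  "monomial M x = (\<Prod>j\<in>#M. coord j x)"

definition polys :: "nat \<Rightarrow> ('f::field ^ 'n \<Rightarrow> 'f) set" where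
  "polys d = fun_space.span (monomial ` multisets_of_size UNIV d)"

lemma polys_add: "f \<in> polys d \<Longrightarrow> g \<in> polys d \<Longrightarrow> (\<lambda>x. f x + g x) \<in> polys d"
  unfolding polys_def by (drule (1) fun_space.span_add) (simp only: plus_fun_def)

lemma polys_scale: "f \<in> polys d \<Longrightarrow> (\<lambda>x. c * f x) \<in> polys d"
  unfolding polys_def by (rule fun_space.span_scale)

lemma polys_sum:
  assumes "\<And>i. i \<in> A \<Longrightarrow> f i \<in> polys d"
  shows "(\<lambda>x. \<Sum>i\<in>A. f i x) \<in> polys d"
proof -
  have "(\<Sum>i\<in>A. f i) \<in> polys d"
    using assms unfolding polys_def by (rule fun_space.span_sum)
  moreover have "(\<Sum>i\<in>A. f i) = (\<lambda>x. \<Sum>i\<in>A. f i x)"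
    by (rule ext) (rule sum_fun_apply)
  ultimately show ?thesis by simp
qed

text \<open>Multiplication by a fixed coordinate is linear, so it suffices to treat monomials, where
  it adds one element to the multiset.\<close>

lemma polys_coord_mult:
  assumes "f \<in> polys d"
  shows "(\<lambda>x. coord j x * f x) \<in> polys (Suc d)"
  using assms unfolding polys_def
proof (induction rule: fun_space.span_induct_alt)
  case base
  show ?case
    using fun_space.span_zero by (simp add: zero_fun_def)
next
  case (step c m f)
  then obtain M where M: "m = monomial M" "size M = d"
    by (auto simp: multisets_of_size_def)
  have "(\<lambda>x. coord j x * m x) = monomial (add_mset j M)"
    by (simp add: M monomial_def fun_eq_iff)
  moreover have "add_mset j M \<in> multisets_of_size UNIV (Suc d)"
    using M by (simp add: multisets_of_size_def)
  ultimately have "(\<lambda>x. coord j x * m x) \<in> polys (Suc d)"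
    unfolding polys_def by (auto intro: fun_space.span_base)
  then have "(\<lambda>x. c * (coord j x * m x) + coord j x * f x) \<in> polys (Suc d)"
    using step.IH by (intro polys_add polys_scale) (simp_all add: polys_def)
  then show ?case
    by (simp add: polys_def algebra_simps)
qed

lemma polys_mono:
  assumes "d \<le> e"
  shows "polys d \<subseteq> polys e"
proof (rule lift_Suc_mono_le[OF _ assms])
  \<comment> \<open>The coordinate \<open>None\<close> is constantly \<open>1\<close>: multiplying
    by it raises the degree but leaves the function unchanged.\<close>
  show "polys k \<subseteq> polys (Suc k)" for k
    using polys_coord_mult[of _ k None] by (auto simp: coord_def)
qed

lemma polys_affine_mult:
  assumes "f \<in> polys d"
  shows "(\<lambda>x. ((\<Sum>i\<in>UNIV. a $ i * x $ i) - b) * f x) \<in> polys (Suc d)"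
proof -
  \<comment> \<open>Homogenised, the affine form is linear in the coordinates, with
    \<open>None\<close> carrying the constant \<open>- b\<close>.\<close>
  have "(\<lambda>x. (\<Sum>i\<in>UNIV. a $ i * (coord (Some i) x * f x)) + (- b) * (coord None x * f x))
      \<in> polys (Suc d)"
    by (intro polys_add polys_sum polys_scale polys_coord_mult assms)
  then show ?thesis
    by (simp add: coord_def sum_distrib_right left_diff_distrib mult.assoc)
qed

text \<open>Each hyperplane contributes one affine factor. A field has no zero divisors, so the zero
  set of the product is the union. The empty cover gives the constant \<open>1\<close>.\<close>

lemma polys_vanishing_on_hyperplanes:
  fixes Hs :: "('f::field ^ 'n) set set"
  assumes "finite Hs" and "\<And>H. H \<in> Hs \<Longrightarrow> affine_hyperplane H"
  shows "\<exists>f\<in>polys (card Hs). \<forall>x. f x = 0 \<longleftrightarrow> x \<in> \<Union>Hs"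
  using assms
proof (induction Hs rule: finite_induct)
  case empty
  have "(monomial {#} :: 'f ^ 'n \<Rightarrow> 'f) \<in> polys 0"
    unfolding polys_def by (rule fun_space.span_base) simp
  then show ?case
    by (intro bexI[of _ "monomial {#}"]) (simp_all add: monomial_def)
next
  case (insert H Hs)
  from insert.IH insert.prems obtain f
    where f: "f \<in> polys (card Hs)" "\<And>x. f x = 0 \<longleftrightarrow> x \<in> \<Union>Hs"
    by (meson insertI2)
  obtain a b where H: "H = {x. (\<Sum>i\<in>UNIV. a $ i * x $ i) = b}"
    using insert.prems[of H] unfolding affine_hyperplane_def by blast
  let ?g = "\<lambda>x. ((\<Sum>i\<in>UNIV. a $ i * x $ i) - b) * f x"
  have "?g \<in> polys (card (insert H Hs))"
    using polys_affine_mult[OF f(1), of a b] insert.hyps by simp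
  then show ?case
    by (rule bexI[of _ ?g, rotated]) (simp add: H f(2))
qed

text \<open>Every \<open>f w\<close> other than \<open>f v\<close> vanishes at \<open>v\<close>,
  hence so does everything in their span; but \<open>f v\<close> does not vanish there.\<close>

lemma independent_separating:
  assumes nz: "\<And>v. v \<in> V \<Longrightarrow> f v v \<noteq> 0"
    and z: "\<And>v w. v \<in> V \<Longrightarrow> w \<in> V \<Longrightarrow> w \<noteq> v \<Longrightarrow> f v w = 0"
  shows "fun_space.independent (f ` V)" and "inj_on f V"
proof -
  show "inj_on f V"
    by (rule inj_onI) (metis nz z)
  show "fun_space.independent (f ` V)"
    unfolding fun_space.dependent_def
  proof (clarify)
    fix v
    assume v: "v \<in> V" "f v \<in> fun_space.span (f ` V - {f v})"
    have "f v v = 0"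
      using v(2)
    proof (induction rule: fun_space.span_induct_alt)
      case base
      show ?case by simp
    next
      case (step c g h)
      then show ?case using z v(1) by auto
    qed
    then show False using nz v(1) by blast
  qed
qed

lemma card_le_of_separating_polys:
  fixes f :: "'f::field ^ 'n \<Rightarrow> 'f ^ 'n \<Rightarrow> 'f"
  assumes "\<And>v. v \<in> V \<Longrightarrow> f v \<in> polys d"
    and "\<And>v. v \<in> V \<Longrightarrow> f v v \<noteq> 0"
    and "\<And>v w. v \<in> V \<Longrightarrow> w \<in> V \<Longrightarrow> w \<noteq> v \<Longrightarrow> f v w = 0"
  shows "card V \<le> (CARD('n) + d) choose d"
proof -
  let ?T = "multisets_of_size (UNIV :: 'n option set) d"
  let ?M = "monomial ` ?T :: ('f ^ 'n \<Rightarrow> 'f) set"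
  note ind = independent_separating[of V f, OF assms(2,3)]
  have fin: "finite ?T" by (rule finite_multisets_of_size) simp
  have "f ` V \<subseteq> fun_space.span ?M"
    using assms(1) unfolding polys_def by blast
  then have "card (f ` V) \<le> card ?M"
    using fun_space.independent_span_bound[OF finite_imageI[OF fin] ind(1)] by blast
  \<comment> \<open>Over a finite field, distinct multisets may give the same monomial function, so
    this is only an inequality.\<close>
  also have "\<dots> \<le> card ?T"
    by (rule card_image_le[OF fin])
  \<comment> \<open>There are \<open>CARD('n) + 1\<close> variables including \<open>None\<close>,
    which cancels the \<open>- 1\<close> in the multiset count.\<close>
  also have "\<dots> = (CARD('n) + d) choose d"
    by (simp add: card_multisets_of_size card_UNIV_option)
  finally show ?thesis
    by (simp add: card_image ind(2))
qed

text \<open>Minimum covers of different points may differ in size; \<open>polys_mono\<close> places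
  all their polynomials in the single space \<open>polys d\<close>.\<close>

lemma card_le_of_almost_covers:
  fixes V :: "('f::field ^ 'n) set"
  assumes "finite V" and "\<And>v. v \<in> V \<Longrightarrow> AC_at V v \<le> d"
  shows "card V \<le> (CARD('n) + d) choose d"
proof -
  have "\<exists>f\<in>polys d. f v \<noteq> 0 \<and> (\<forall>w\<in>V. w \<noteq> v \<longrightarrow> f w = 0)" if v: "v \<in> V" for v
  proof -
    obtain Hs where Hs: "almost_cover V v Hs" "card Hs = AC_at V v"
      using AC_at_attained[OF assms(1)] by blast
    then obtain f where f: "f \<in> polys (card Hs)" "\<And>x. f x = 0 \<longleftrightarrow> x \<in> \<Union>Hs"
      using polys_vanishing_on_hyperplanes[of Hs] by (auto simp: almost_cover_def)
    have "f \<in> polys d"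
      using f(1) polys_mono[of "card Hs" d] assms(2)[OF v] Hs(2) by auto
    moreover have "f v \<noteq> 0 \<and> (\<forall>w\<in>V. w \<noteq> v \<longrightarrow> f w = 0)"
      using Hs(1) unfolding almost_cover_def f(2) by blast
    ultimately show ?thesis by blast
  qed
  then obtain f where "\<And>v. v \<in> V \<Longrightarrow>
      f v \<in> polys d \<and> f v v \<noteq> 0 \<and> (\<forall>w\<in>V. w \<noteq> v \<longrightarrow> f v w = 0)"
    by metis
  then show ?thesis
    by (intro card_le_of_separating_polys[of V f]) auto
qed

lemma power_self_less_fact_mult_exp:
  assumes "n > 0"
  shows "real n ^ n < fact n * exp (real n)"
proof -
  let ?t = "\<lambda>k. real n ^ k /\<^sub>R fact k"
  have t: "?t sums exp (real n)"
    by (rule exp_converges)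
  \<comment> \<open>Two terms of the exponential series suffice: term \<open>n\<close> gives the
    bound, and term \<open>0\<close>, distinct since \<open>n > 0\<close>, makes it strict.\<close>
  have "sum ?t {0, n} \<le> suminf ?t"
    by (rule sum_le_suminf[OF sums_summable[OF t]]) auto
  then have "1 + real n ^ n / fact n \<le> exp (real n)"
    using assms sums_unique[OF t] by (simp add: divide_inverse_commute)
  then have "real n ^ n / fact n < exp (real n)" by linarith
  then show ?thesis
    by (simp add: pos_divide_less_eq mult.commute)
qed

lemma binomial_root_bound:
  assumes n: "n > 0" and N: "N \<le> (n + d) choose d"
  shows "real n * real N powr (1 / real n) / exp 1 < real n + real d"
proof -
  define r where "r = real N powr (1 / real n)"
  have r: "r \<ge> 0" "r ^ n = real N"
    using n by (simp_all add: r_def root_powr_inverse[symmetric])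
  \<comment> \<open>By symmetry the coefficient is \<open>(n + d) choose n\<close>, which brings in
    \<open>fact n\<close> and the exponent \<open>n\<close>.\<close>
  have "((n + d) choose d) * fact n \<le> (n + d) ^ n"
    using binomial_fact_pow[of "n + d" n] binomial_symmetric[of n "n + d"] by simp
  with N have "N * fact n \<le> (n + d) ^ n"
    by (meson le_trans mult_le_mono1)
  then have bound: "real N * fact n \<le> (real n + real d) ^ n"
    by (metis of_nat_add of_nat_fact of_nat_le_iff of_nat_mult of_nat_power)
  have "real n * r < exp 1 * (real n + real d)"
  \<comment> \<open>The bases are compared through their \<open>n\<close>-th powers; strictness
    there needs a positive factor \<open>real N\<close>, so \<open>N = 0\<close> is
    separate.\<close>
  proof (cases "N = 0")
    case True
    then show ?thesis using n by (simp add: r_def add_pos_nonneg)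
  next
    case False
    have "(real n * r) ^ n = real N * real n ^ n"
      by (simp add: power_mult_distrib r)
    also have "\<dots> < real N * (fact n * exp (real n))"
      using False power_self_less_fact_mult_exp[OF n] by simp
    also have "\<dots> \<le> (real n + real d) ^ n * exp (real n)"
      using bound by (simp add: mult.assoc[symmetric])
    also have "\<dots> = (exp 1 * (real n + real d)) ^ n"
      using exp_of_nat_mult[of n "1::real"] by (simp add: power_mult_distrib)
    finally show ?thesis
      by (rule power_less_imp_less_base) simp
  qed
  then show ?thesis
    by (simp add: r_def pos_divide_less_eq mult.commute)
qed

theorem corollary1p7:
  fixes V :: "('f::field ^ 'n) set"
  assumes "finite V" and "V \<noteq> {}"
  shows "real CARD('n) * real (card V) powr (1 / real CARD('n)) / exp 1 - real CARD('n)
           < real (AC V)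
         \<and> (\<exists>v\<in>V. real CARD('n) * real (card V) powr (1 / real CARD('n)) / exp 1 - real CARD('n)
           < real (AC_at V v))"
proof -
  have "AC V \<in> AC_at V ` V" and le: "\<And>v. v \<in> V \<Longrightarrow> AC_at V v \<le> AC V"
    using assms unfolding AC_def by (auto intro!: Max_in)
  \<comment> \<open>At a point attaining the maximum, both conjuncts are the same
    inequality.\<close>
  then obtain v where v: "v \<in> V" "AC V = AC_at V v" by blast
  have "real CARD('n) * real (card V) powr (1 / real CARD('n)) / exp 1
      < real CARD('n) + real (AC V)"
    by (rule binomial_root_bound[OF zero_less_card_finite card_le_of_almost_covers[OF assms(1) le]])
  then have "real CARD('n) * real (card V) powr (1 / real CARD('n)) / exp 1 - real CARD('n)
      < real (AC V)"
    by linarith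
  then show ?thesis
    using v by metis
qed

end
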